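(* Let $1 < \kappa < \lambda$ be cardinals with $\lambda$ regular, and suppose that there is a stationary set $S \subseteq \lambda$ such that $\mathsf{sDSR}({<}\kappa, S)$ holds. Then $\square(\lambda, {<}\kappa)$ fails.
   Context: For an ordinal $\alpha$ and a set $S$ of ordinals, $S$ reflects at $\alpha$ if $\mathrm{cf}(\alpha) > \omega$ and $S \cap \alpha$ is stationary in $\alpha$. For $\lambda$ regular uncountable, $S \subseteq \lambda$ stationary and $\kappa \le \lambda$, $\mathsf{sDSR}({<}\kappa, S)$ is the assertion: whenever $\langle S_{\alpha,i} \mid \alpha<\lambda,\ i<j_\alpha\rangle$ is a matrix of stationary subsets of $S$ with $j_\alpha < \kappa$ for every $\alpha<\lambda$, there are an ordinal $\gamma<\lambda$ of uncountable cofinality and a stationary set $F \subseteq \gamma$ such that for every $\alpha \in F$ and every $i<j_\alpha$, $S_{\alpha,i}$ reflects at $\gamma$. A coherent sequence of length $\lambda$ is a sequence $\langle \mathcal{C}_\alpha \mid \alpha<\lambda \text{ limit}\rangle$ such that each $\mathcal{C}_\alpha$ is a nonempty collection of clubs in $\alpha$ and for every $C \in \mathcal{C}_\alpha$ and every limit point $\beta<\alpha$ of $C$, $C\cap\beta \in \mathcal{C}_\beta$; it has width ${<}\kappa$ if $|\mathcal{C}_\alpha|<\kappa$ for all limit $\alpha$. A thread is a club $T\subseteq\lambda$ such that $T\cap\beta\in\mathcal{C}_\beta$ for every limit point $\beta<\lambda$ of $T$. $\square(\lambda,{<}\kappa)$ asserts the existence of a coherent sequence of length $\lambda$ and width ${<}\kappa$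 with no thread. *)

theory Defs
  imports Main "HOL-Library.Equipollence" "HOL-Library.Countable_Set"
begin

text \<open>Ordinals below lambda are the elements of a well-ordered type 'a whose
  order type is lambda; an ordinal gamma < lambda is identified with the set of
  its predecessors, and lambda itself with UNIV.\<close>

definition is_limit :: "'a::wellorder \<Rightarrow> bool" where
  "is_limit \<beta> \<longleftrightarrow> (\<exists>\<xi>. \<xi> < \<beta>) \<and> (\<forall>\<xi><\<beta>. \<exists>\<eta>. \<xi> < \<eta> \<and> \<eta> < \<beta>)"

definition limit_point :: "'a::wellorder set \<Rightarrow> 'a \<Rightarrow> bool" where
  "limit_point C \<beta> \<longleftrightarrow> is_limit \<beta> \<and> (\<forall>\<xi><\<beta>. \<exists>c\<in>C. \<xi> < c \<and> c < \<beta>)"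

text \<open>C is a club in the ordinal A (A = {..<alpha} or A = UNIV for lambda).\<close>
definition club_in :: "'a::wellorder set \<Rightarrow> 'a set \<Rightarrow> bool" where
  "club_in A C \<longleftrightarrow> C \<subseteq> A \<and> (\<forall>\<xi>\<in>A. \<exists>c\<in>C. \<xi> \<le> c)
      \<and> (\<forall>\<beta>\<in>A. limit_point C \<beta> \<longrightarrow> \<beta> \<in> C)"

definition stationary_in :: "'a::wellorder set \<Rightarrow> 'a set \<Rightarrow> bool" where
  "stationary_in A X \<longleftrightarrow> (\<forall>C. club_in A C \<longrightarrow> X \<inter> C \<noteq> {})"

definition uncountable_cof :: "'a::wellorder \<Rightarrow> bool" where
  "uncountable_cof \<gamma> \<longleftrightarrow>
     \<not> (\<exists>X. X \<subseteq> {..<\<gamma>} \<and> countable X \<and> (\<forall>\<xi><\<gamma>. \<exists>x\<in>X. \<xi> \<le> x))"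

definition reflects_at :: "'a::wellorder set \<Rightarrow> 'a \<Rightarrow> bool" where
  "reflects_at S \<gamma> \<longleftrightarrow> uncountable_cof \<gamma> \<and> stationary_in {..<\<gamma>} (S \<inter> {..<\<gamma>})"

definition regular_uncountable :: "'a::wellorder itself \<Rightarrow> bool" where
  "regular_uncountable _ \<longleftrightarrow> \<not> countable (UNIV :: 'a set)
     \<and> (\<forall>x::'a. {..<x} \<prec> (UNIV :: 'a set))
     \<and> (\<forall>X::'a set. (\<forall>\<xi>. \<exists>x\<in>X. \<xi> \<le> x) \<longrightarrow> \<not> X \<prec> (UNIV :: 'a set))"

definition is_cardinal :: "'a::wellorder \<Rightarrow> bool" where
  "is_cardinal \<kappa> \<longleftrightarrow> (\<forall>\<xi><\<kappa>. {..<\<xi>} \<prec> {..<\<kappa>})"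

definition sDSR :: "'a::wellorder \<Rightarrow> 'a set \<Rightarrow> bool" where
  "sDSR \<kappa> S \<longleftrightarrow>
    (\<forall>(M :: 'a \<Rightarrow> 'a \<Rightarrow> 'a set) (j :: 'a \<Rightarrow> 'a).
       (\<forall>\<alpha>. j \<alpha> < \<kappa>) \<and>
       (\<forall>\<alpha> i. i < j \<alpha> \<longrightarrow> M \<alpha> i \<subseteq> S \<and> stationary_in UNIV (M \<alpha> i))
       \<longrightarrow> (\<exists>\<gamma> F. uncountable_cof \<gamma> \<and> F \<subseteq> {..<\<gamma>} \<and> stationary_in {..<\<gamma>} F \<and>
              (\<forall>\<alpha>\<in>F. \<forall>i<j \<alpha>. reflects_at (M \<alpha> i) \<gamma>)))"

definition coherent_seq :: "('a::wellorder \<Rightarrow> 'a set set) \<Rightarrow> bool" where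
  "coherent_seq \<C> \<longleftrightarrow> (\<forall>\<alpha>. is_limit \<alpha> \<longrightarrow> \<C> \<alpha> \<noteq> {} \<and>
      (\<forall>C\<in>\<C> \<alpha>. club_in {..<\<alpha>} C \<and>
         (\<forall>\<beta><\<alpha>. limit_point C \<beta> \<longrightarrow> C \<inter> {..<\<beta>} \<in> \<C> \<beta>)))"

definition width_less :: "('a::wellorder \<Rightarrow> 'a set set) \<Rightarrow> 'a \<Rightarrow> bool" where
  "width_less \<C> \<kappa> \<longleftrightarrow> (\<forall>\<alpha>. is_limit \<alpha> \<longrightarrow> \<C> \<alpha> \<prec> {..<\<kappa>})"

definition is_thread :: "('a::wellorder \<Rightarrow> 'a set set) \<Rightarrow> 'a set \<Rightarrow> bool" where
  "is_thread \<C> T \<longleftrightarrow> club_in UNIV T \<and> (\<forall>\<beta>. limit_point T \<beta> \<longrightarrow> T \<inter> {..<\<beta>} \<in> \<C> \<beta>)"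

definition square :: "'a::wellorder \<Rightarrow> bool" where
  "square \<kappa> \<longleftrightarrow> (\<exists>\<C>. coherent_seq \<C> \<and> width_less \<C> \<kappa> \<and> \<not> (\<exists>T. is_thread \<C> T))"

end

theory Submission
  imports Defs
begin

text \<open>Suppose \<open>\<C>\<close> witnesses the square principle. Call \<open>C \<in> \<C> \<alpha>\<close> bad if almost all
  \<open>\<beta> \<in> S\<close>, modulo clubs, have some \<open>D \<in> \<C> \<beta>\<close> with \<open>D \<inter> \<alpha> = C\<close>.

  If bad sets occur only at boundedly many \<open>\<alpha>\<close>, the sets
  \<open>{\<beta> \<in> S. \<beta> > \<alpha> \<and> (\<forall>D \<in> \<C> \<beta>. D \<inter> \<alpha> \<noteq> C)}\<close> form a matrix of stationary sets. Reflecting it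
  at \<open>\<gamma>\<close> along \<open>F\<close>, taking \<open>C \<in> \<C> \<gamma>\<close>, a limit point \<open>\<alpha> \<in> F\<close> of \<open>C\<close> and then a limit point
  \<open>\<beta>\<close> of \<open>C\<close> in the set attached to \<open>C \<inter> \<alpha>\<close> contradicts \<open>C \<inter> \<beta> \<in> \<C> \<beta>\<close>.

  Otherwise choose a bad set \<open>B \<alpha>\<close> for unboundedly many \<open>\<alpha>\<close>, and order these \<open>\<alpha>\<close> as a tree by
  end-extension of \<open>B \<alpha>\<close>. If the cone above some node is an unbounded chain, the union along it
  is a thread. If not, every node \<open>u\<close> has two extensions \<open>v\<close> and \<open>w\<close> without common extensions
  beyond some bound. Along a set of nodes sparse enough to exceed all earlier bounds, the map
  sending \<open>u\<close> to the pair of elements of \<open>\<C> \<beta>\<close> that extend \<open>B v\<close> and \<open>B w\<close> is injective,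
  for a suitable \<open>\<beta> \<in> S\<close>, which contradicts the width of \<open>\<C>\<close>.\<close>

section \<open>Cofinality and clubs\<close>

lemma is_limit_if_uncountable_cof:
  assumes "uncountable_cof \<gamma>"
  shows "is_limit \<gamma>"
proof -
  have nc: "\<exists>\<xi><\<gamma>. \<forall>x\<in>X. x < \<xi>" if "X \<subseteq> {..<\<gamma>}" "countable X" for X
    using assms that unfolding uncountable_cof_def by (meson not_le)
  have "\<exists>\<eta>. \<xi> < \<eta> \<and> \<eta> < \<gamma>" if "\<xi> < \<gamma>" for \<xi>
    using nc[of "{\<xi>}"] that by auto
  then show ?thesis
    using nc[of "{}"] unfolding is_limit_def by auto
qed

lemma regular_bounded:
  fixes X :: "'a::wellorder set"
  assumes "regular_uncountable TYPE('a)" and "X \<prec> (UNIV :: 'a set)"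
  shows "\<exists>b. \<forall>x\<in>X. x < b"
  using assms unfolding regular_uncountable_def by (meson not_le)

lemma regular_countable_lesspoll:
  fixes X :: "'b set"
  assumes "regular_uncountable TYPE('a::wellorder)" and "countable X"
  shows "X \<prec> (UNIV :: 'a set)"
proof -
  have "\<not> (UNIV :: 'a set) \<lesssim> X"
    using assms countable_lepoll unfolding regular_uncountable_def by blast
  moreover have "X \<lesssim> (UNIV :: 'a set)"
  proof -
    have "infinite (UNIV :: 'a set)"
      using assms(1) countable_finite unfolding regular_uncountable_def by blast
    then have "(UNIV :: nat set) \<lesssim> (UNIV :: 'a set)"
      using infinite_le_lepoll by blast
    moreover have "X \<lesssim> (UNIV :: nat set)"
      using assms(2) unfolding countable_def lepoll_def by auto
    ultimately show ?thesis
      using lepoll_trans by blast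
  qed
  ultimately show ?thesis
    unfolding lesspoll_def using eqpoll_imp_lepoll eqpoll_sym by blast
qed

lemma regular_countable_bounded:
  fixes X :: "'a::wellorder set"
  assumes "regular_uncountable TYPE('a)" and "countable X"
  shows "\<exists>b. \<forall>x\<in>X. x < b"
  using regular_bounded regular_countable_lesspoll assms by blast

lemma regular_no_max:
  fixes x :: "'a::wellorder"
  assumes "regular_uncountable TYPE('a)"
  shows "\<exists>y. x < y"
  using regular_countable_bounded[OF assms, of "{x}"] by auto

lemma regular_image_bounded:
  fixes f :: "'a::wellorder \<Rightarrow> 'a"
  assumes "regular_uncountable TYPE('a)"
  shows "\<exists>b. \<forall>y\<le>x. f y < b"
proof -
  obtain z where "x < z"
    using regular_no_max[OF assms] by blast
  have "f ` {..<z} \<lesssim> {..<z}"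
    by (rule image_lepoll)
  moreover have "{..<z} \<prec> (UNIV :: 'a set)"
    using assms unfolding regular_uncountable_def by blast
  ultimately obtain b where "\<forall>y\<in>f ` {..<z}. y < b"
    using regular_bounded[OF assms] lesspoll_trans1 by blast
  then show ?thesis
    using \<open>x < z\<close> by (intro exI[of _ b]) auto
qed

text \<open>The supremum of the iterates of \<open>f\<close> from \<xi> works. As \<open>f\<close>
  need not be monotone, the conclusion bounds \<open>f y\<close> at an iterate \<open>y\<close>
  above \<open>x\<close> rather than \<open>f x\<close>. \<open>A\<close> is later an ordinal of
  uncountable cofinality or the whole type.\<close>

lemma countable_closure_point:
  fixes f :: "'a::wellorder \<Rightarrow> 'a"
  assumes bdd: "\<And>X. X \<subseteq> A \<Longrightarrow> countable X \<Longrightarrow> \<exists>b\<in>A. \<forall>x\<in>X. x < b"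
    and down: "\<And>x y. y \<in> A \<Longrightarrow> x < y \<Longrightarrow> x \<in> A"
    and "\<xi> \<in> A"
    and f: "\<And>x. x \<in> A \<Longrightarrow> f x \<in> A" "\<And>x. x \<in> A \<Longrightarrow> x < f x"
  shows "\<exists>e\<in>A. \<xi> < e \<and> (\<forall>x<e. \<exists>y\<in>A. x \<le> y \<and> f y < e)"
proof -
  define s where "s n = (f ^^ n) \<xi>" for n
  have s: "s n \<in> A" for n
    by (induction n) (auto simp: s_def assms)
  obtain b where b: "b \<in> A" "\<forall>n. s n < b"
    using bdd[of "range s"] s by auto
  define e where "e = (LEAST e. \<forall>n. s n < e)"
  have e: "\<forall>n. s n < e"
    unfolding e_def using b(2) by (rule LeastI)
  have "e \<le> b"
    unfolding e_def using b(2) by (rule Least_le)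
  then have "e \<in> A"
    using b(1) down by (cases "e = b") auto
  moreover have "\<exists>y\<in>A. x \<le> y \<and> f y < e" if "x < e" for x
  proof -
    have "\<not> (\<forall>n. s n < x)"
      using that not_less_Least unfolding e_def by blast
    then obtain n where "x \<le> s n"
      using not_le by blast
    moreover have "f (s n) < e"
      using e[rule_format, of "Suc n"] by (simp add: s_def)
    ultimately show ?thesis
      using s by blast
  qed
  moreover have "\<xi> < e"
    using e[rule_format, of 0] by (simp add: s_def)
  ultimately show ?thesis
    by blast
qed


text \<open>Uncountable cofinality yields unboundedness: \<omega> steps to ever larger elements of
  \<open>C\<close> lead to a limit point of \<open>C\<close> still below \<gamma>.\<close>

lemma club_in_limit_points:
  assumes unc: "uncountable_cof \<gamma>" and C: "club_in {..<\<gamma>} C"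
  shows "club_in {..<\<gamma>} {\<beta>. \<beta> < \<gamma> \<and> limit_point C \<beta>}"
proof -
  have lim: "is_limit \<gamma>"
    using unc by (rule is_limit_if_uncountable_cof)
  have "\<exists>c\<in>C. x < c" if x: "x < \<gamma>" for x
  proof -
    obtain y where "x < y" "y < \<gamma>"
      using lim x unfolding is_limit_def by blast
    then obtain c where "c \<in> C" "y \<le> c"
      using C unfolding club_in_def by (meson lessThan_iff)
    then show ?thesis
      using \<open>x < y\<close> less_le_trans by blast
  qed
  then obtain f where f: "\<And>x. x < \<gamma> \<Longrightarrow> f x \<in> C \<and> x < f x"
    by metis
  have C_sub: "C \<subseteq> {..<\<gamma>}"
    using C unfolding club_in_def by blast
  have unb: "\<exists>e\<in>{\<beta>. \<beta> < \<gamma> \<and> limit_point C \<beta>}. \<xi> \<le> e" if "\<xi> < \<gamma>" for \<xi>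
  proof -
    have "\<exists>e\<in>{..<\<gamma>}. \<xi> < e \<and> (\<forall>x<e. \<exists>y\<in>{..<\<gamma>}. x \<le> y \<and> f y < e)"
    proof (rule countable_closure_point)
      show "\<exists>b\<in>{..<\<gamma>}. \<forall>x\<in>X. x < b" if "X \<subseteq> {..<\<gamma>}" "countable X" for X
        using unc that unfolding uncountable_cof_def by (meson lessThan_iff not_le)
    qed (use f C_sub that in auto)
    then obtain e where e: "e < \<gamma>" "\<xi> < e"
      "\<forall>x<e. \<exists>y\<in>{..<\<gamma>}. x \<le> y \<and> f y < e"
      by blast
    have between: "\<exists>c\<in>C. x < c \<and> c < e" if "x < e" for x
      using e(3) that f le_less_trans by (metis lessThan_iff)
    then have "limit_point C e"
      using e(2) unfolding limit_point_def is_limit_def by blast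
    then show ?thesis
      using e by auto
  qed
  have "limit_point C \<beta>" if "limit_point {\<beta>. \<beta> < \<gamma> \<and> limit_point C \<beta>} \<beta>" for \<beta>
  proof -
    have "\<exists>c\<in>C. \<xi> < c \<and> c < \<beta>" if "\<xi> < \<beta>" for \<xi>
    proof -
      obtain b where "limit_point C b" "\<xi> < b" "b < \<beta>"
        using \<open>limit_point {\<beta>. \<beta> < \<gamma> \<and> limit_point C \<beta>} \<beta>\<close> \<open>\<xi> < \<beta>\<close>
        unfolding limit_point_def by blast
      then show ?thesis
        unfolding limit_point_def using less_trans by blast
    qed
    then show ?thesis
      using that unfolding limit_point_def by blast
  qed
  then show ?thesis
    using unb unfolding club_in_def by blast
qed

lemma club_in_Int_greaterThan:
  assumes C: "club_in A C" and succ: "\<exists>y\<in>A. \<rho> < y"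
  shows "club_in A (C \<inter> {\<rho><..})"
proof -
  have "\<exists>c\<in>C \<inter> {\<rho><..}. \<xi> \<le> c" if "\<xi> \<in> A" for \<xi>
  proof -
    obtain y where y: "y \<in> A" "\<rho> < y"
      using succ by blast
    have "max \<xi> y \<in> A"
      using y that by (simp add: max_def)
    then obtain c where "c \<in> C" "max \<xi> y \<le> c"
      using C unfolding club_in_def by blast
    then show ?thesis
      using y by (intro bexI[of _ c]) auto
  qed
  moreover have "\<beta> \<in> C \<inter> {\<rho><..}" if \<beta>: "\<beta> \<in> A" "limit_point (C \<inter> {\<rho><..}) \<beta>" for \<beta>
  proof -
    have "limit_point C \<beta>"
      using \<beta>(2) unfolding limit_point_def by blast
    moreover obtain c where "c \<in> C \<inter> {\<rho><..}" "c < \<beta>"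
      using \<beta>(2) unfolding limit_point_def is_limit_def by blast
    ultimately show ?thesis
      using C \<beta>(1) unfolding club_in_def by auto
  qed
  ultimately show ?thesis
    using C unfolding club_in_def by blast
qed

lemma stationary_in_Int_greaterThan:
  assumes "stationary_in A S" and "\<exists>y\<in>A. \<rho> < y"
  shows "stationary_in A (S \<inter> {\<rho><..})"
  using assms club_in_Int_greaterThan unfolding stationary_in_def
  by (metis inf_assoc inf_commute)

text \<open>The first conjunct excludes the least element, which is closed vacuously. If
  \<open>x < f x\<close> for all \<open>x\<close>, every closure point is therefore a limit.\<close>

definition closure_points :: "('a::wellorder \<Rightarrow> 'a) \<Rightarrow> 'a set" where
  "closure_points f = {e. (\<exists>\<xi>. \<xi> < e) \<and> (\<forall>x<e. f x < e)}"

lemma club_in_closure_points: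
  fixes f :: "'a::wellorder \<Rightarrow> 'a"
  assumes reg: "regular_uncountable TYPE('a)"
  shows "club_in UNIV (closure_points f)"
proof -
  \<comment> \<open>By regularity a single value \<open>g x\<close> exceeds \<open>f\<close> on all
    of the segment up to \<open>x\<close>. Bounding \<open>g\<close> on a set cofinal in
    \<open>e\<close> then bounds \<open>f\<close> everywhere below \<open>e\<close>.\<close>
  have "\<exists>b>x. \<forall>y\<le>x. f y < b" for x
  proof -
    obtain b where "\<forall>y\<le>x. f y < b"
      using regular_image_bounded[OF reg] by blast
    moreover obtain c where "x < c"
      using regular_no_max[OF reg] by blast
    ultimately show ?thesis
      by (intro exI[of _ "max b c"]) (auto simp: less_max_iff_disj)
  qed
  then obtain g where g: "\<And>x. x < g x" "\<And>x y. y \<le> x \<Longrightarrow> f y < g x"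
    by metis
  have "\<exists>e\<in>closure_points f. \<xi> \<le> e" for \<xi>
  proof -
    have "\<exists>e\<in>UNIV. \<xi> < e \<and> (\<forall>x<e. \<exists>y\<in>UNIV. x \<le> y \<and> g y < e)"
      by (rule countable_closure_point) (use g regular_countable_bounded[OF reg] in auto)
    then obtain e where e: "\<xi> < e" "\<And>x. x < e \<Longrightarrow> \<exists>y. x \<le> y \<and> g y < e"
      by auto
    then have "f x < e" if "x < e" for x
      using g(2) that less_trans by blast
    then show ?thesis
      using e(1) unfolding closure_points_def by (intro bexI[of _ e]) auto
  qed
  moreover have "\<beta> \<in> closure_points f" if lp: "limit_point (closure_points f) \<beta>" for \<beta>
  proof -
    have "f x < \<beta>" if x: "x < \<beta>" for x
    proof -
      obtain c where "c \<in> closure_points f" "x < c" "c < \<beta>"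
        using lp x unfolding limit_point_def by blast
      then show ?thesis
        unfolding closure_points_def using less_trans by blast
    qed
    then show ?thesis
      using lp unfolding closure_points_def limit_point_def is_limit_def by blast
  qed
  ultimately show ?thesis
    unfolding club_in_def by blast
qed

section \<open>Cardinality\<close>

text \<open>Elements of \<open>X\<close> are listed without repetition until none is left; a list
  still running at \<kappa> would inject \<open>{..<\<kappa>}\<close> into \<open>X\<close>. The
  lemma serves to index \<open>\<C> \<alpha>\<close> as a row of a matrix.\<close>

lemma surj_from_initial_segment:
  fixes X :: "'b set" and \<kappa> :: "'a::wellorder"
  assumes X: "X \<prec> {..<\<kappa>}"
  shows "\<exists>\<xi><\<kappa>. \<exists>g. X = g ` {..<\<xi>}"
proof -
  have "\<exists>g :: 'a \<Rightarrow> 'b. \<forall>x. X \<subseteq> g ` {..<x} \<or> g x \<in> X - g ` {..<x}"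
  proof (rule dependent_wellorder_choice)
    fix r and f g :: "'a \<Rightarrow> 'b" and x
    assume "\<And>y. y < x \<Longrightarrow> f y = g y"
    then have "f ` {..<x} = g ` {..<x}"
      by auto
    then show "(X \<subseteq> f ` {..<x} \<or> r \<in> X - f ` {..<x}) = (X \<subseteq> g ` {..<x} \<or> r \<in> X - g ` {..<x})"
      by simp
  qed blast
  then obtain g :: "'a \<Rightarrow> 'b" where g: "\<And>x. X \<subseteq> g ` {..<x} \<or> g x \<in> X - g ` {..<x}"
    by blast
  have "\<exists>\<xi><\<kappa>. X \<subseteq> g ` {..<\<xi>}"
  proof (rule ccontr)
    assume "\<not> ?thesis"
    then have new: "g x \<in> X" "g x \<notin> g ` {..<x}" if "x < \<kappa>" for x
      using g that by blast+
    have "inj_on g {..<\<kappa>}"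
    proof (rule linorder_inj_onI)
      show "g x \<noteq> g y" if "x < y" "y \<in> {..<\<kappa>}" for x y
        using new(2)[of y] that by (metis imageI lessThan_iff)
    qed auto
    then have "{..<\<kappa>} \<lesssim> X"
      using new(1) unfolding lepoll_def by blast
    then show False
      using X lesspoll_trans1 lesspoll_not_refl by blast
  qed
  \<comment> \<open>Minimality of \<xi> makes every value \<open>g i\<close> with
    \<open>i < \<xi>\<close> an element of \<open>X\<close>, so that the image is exactly
    \<open>X\<close>.\<close>
  then obtain \<xi> where \<xi>: "\<xi> < \<kappa>" "X \<subseteq> g ` {..<\<xi>}" "\<And>i. i < \<xi> \<Longrightarrow> \<not> X \<subseteq> g ` {..<i}"
    using exists_least_iff[of "\<lambda>\<xi>. \<xi> < \<kappa> \<and> X \<subseteq> g ` {..<\<xi>}"] less_trans by metis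
  then have "X = g ` {..<\<xi>}"
    using g by blast
  then show ?thesis
    using \<xi>(1) by blast
qed

lemma infinite_square_eqpoll:
  assumes "infinite X"
  shows "X \<times> X \<approx> X"
  using card_of_Times_same_infinite[OF assms] by (simp add: eqpoll_iff_card_of_ordIso)

section \<open>Coherent sequences\<close>

text \<open>\<open>C\<close> is bad exactly when this set is nonstationary.\<close>

definition uncovered :: "('a::wellorder \<Rightarrow> 'a set set) \<Rightarrow> 'a set \<Rightarrow> 'a \<Rightarrow> 'a set \<Rightarrow> 'a set" where
  "uncovered \<C> S \<alpha> C = {\<beta>\<in>S. \<alpha> < \<beta> \<and> \<not> (\<exists>D\<in>\<C> \<beta>. D \<inter> {..<\<alpha>} = C)}"

lemma unbounded_nonstationary_uncovered:
  fixes \<C> :: "'a::wellorder \<Rightarrow> 'a set set"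
  assumes reg: "regular_uncountable TYPE('a)"
    and \<kappa>: "\<exists>a b. a < b \<and> b < \<kappa>"
    and S: "stationary_in UNIV S" and dsr: "sDSR \<kappa> S"
    and coh: "coherent_seq \<C>" and width: "width_less \<C> \<kappa>"
  shows "\<exists>\<alpha>>\<rho>. is_limit \<alpha> \<and> (\<exists>C\<in>\<C> \<alpha>. \<not> stationary_in UNIV (uncovered \<C> S \<alpha> C))"
proof (rule ccontr)
  assume "\<not> ?thesis"
  then have stat: "stationary_in UNIV (uncovered \<C> S \<alpha> C)"
    if "\<rho> < \<alpha>" "is_limit \<alpha>" "C \<in> \<C> \<alpha>" for \<alpha> C
    using that by blast
  obtain a b where ab: "a < b" "b < \<kappa>"
    using \<kappa> by blast
  \<comment> \<open>Every row is given at least one entry, also at non-limit \<alpha>, so that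
    reflection along \<open>F\<close> always yields a set reflecting at \<gamma>.\<close>
  have "\<exists>\<xi> g. \<xi> < \<kappa> \<and> (\<exists>i. i < \<xi>) \<and> (is_limit \<alpha> \<longrightarrow> \<C> \<alpha> = g ` {..<\<xi>})" for \<alpha>
  proof (cases "is_limit \<alpha>")
    case True
    then have "\<C> \<alpha> \<prec> {..<\<kappa>}"
      using width unfolding width_less_def by blast
    from surj_from_initial_segment[OF this]
    obtain \<xi> g where "\<xi> < \<kappa>" "\<C> \<alpha> = g ` {..<\<xi>}"
      by blast
    moreover have "\<C> \<alpha> \<noteq> {}"
      using coh True unfolding coherent_seq_def by blast
    ultimately have "\<xi> < \<kappa> \<and> (\<exists>i. i < \<xi>) \<and> (is_limit \<alpha> \<longrightarrow> \<C> \<alpha> = g ` {..<\<xi>})"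
      by auto
    then show ?thesis
      by blast
  qed (use ab in blast)
  then obtain j g where j: "\<And>\<alpha>. j \<alpha> < \<kappa>" "\<And>\<alpha>. \<exists>i. i < j \<alpha>"
    and g: "\<And>\<alpha>. is_limit \<alpha> \<Longrightarrow> \<C> \<alpha> = g \<alpha> ` {..<j \<alpha>}"
    by metis
  \<comment> \<open>The default is stationary and, like the other entries, lies above \<rho>; this
    forces \<rho> < \<gamma> below.\<close>
  define M where "M \<alpha> i = (if \<rho> < \<alpha> \<and> is_limit \<alpha> then uncovered \<C> S \<alpha> (g \<alpha> i) else S \<inter> {\<rho><..})"
    for \<alpha> i
  have M: "M \<alpha> i \<subseteq> S" "M \<alpha> i \<subseteq> {\<rho><..}" for \<alpha> i
    unfolding M_def uncovered_def by auto
  have "stationary_in UNIV (S \<inter> {\<rho><..})"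
    using S regular_no_max[OF reg] by (intro stationary_in_Int_greaterThan) auto
  then have "stationary_in UNIV (M \<alpha> i)" if "i < j \<alpha>" for \<alpha> i
    using stat g that unfolding M_def by auto
  then obtain \<gamma> F where unc: "uncountable_cof \<gamma>" and F: "stationary_in {..<\<gamma>} F"
    and refl: "\<And>\<alpha> i. \<alpha> \<in> F \<Longrightarrow> i < j \<alpha> \<Longrightarrow> reflects_at (M \<alpha> i) \<gamma>"
    using dsr[unfolded sDSR_def, rule_format, of j M] j(1) M(1) by blast
  have lim: "is_limit \<gamma>"
    using unc by (rule is_limit_if_uncountable_cof)
  have club: "club_in {..<\<gamma>} {..<\<gamma>}"
    unfolding club_in_def by auto
  have "\<rho> < \<gamma>"
  proof -
    obtain \<alpha> where "\<alpha> \<in> F"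
      using F club unfolding stationary_in_def by blast
    moreover obtain i where "i < j \<alpha>"
      using j(2) by blast
    ultimately obtain \<beta> where "\<beta> \<in> M \<alpha> i" "\<beta> < \<gamma>"
      using refl club unfolding reflects_at_def stationary_in_def by blast
    then have "\<rho> < \<beta>"
      using M(2) by blast
    then show ?thesis
      using \<open>\<beta> < \<gamma>\<close> by (rule less_trans)
  qed
  then have succ: "\<exists>y\<in>{..<\<gamma>}. \<rho> < y"
    using lim unfolding is_limit_def by (meson lessThan_iff)
  obtain C where C: "C \<in> \<C> \<gamma>"
    using coh lim unfolding coherent_seq_def by blast
  then have C': "club_in {..<\<gamma>} C" "\<And>\<beta>. \<beta> < \<gamma> \<Longrightarrow> limit_point C \<beta> \<Longrightarrow> C \<inter> {..<\<beta>} \<in> \<C> \<beta>"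
    using coh lim unfolding coherent_seq_def by blast+
  let ?acc = "{\<beta>. \<beta> < \<gamma> \<and> limit_point C \<beta>}"
  have acc: "club_in {..<\<gamma>} ?acc"
    using unc C'(1) by (rule club_in_limit_points)
  have "F \<inter> (?acc \<inter> {\<rho><..}) \<noteq> {}"
    using F club_in_Int_greaterThan[OF acc succ] unfolding stationary_in_def by blast
  then obtain \<alpha> where \<alpha>: "\<alpha> \<in> F" "\<alpha> < \<gamma>" "limit_point C \<alpha>" "\<rho> < \<alpha>"
    by auto
  then have "is_limit \<alpha>"
    unfolding limit_point_def by blast
  moreover from this obtain i where i: "i < j \<alpha>" "C \<inter> {..<\<alpha>} = g \<alpha> i"
    using C'(2) \<alpha> g by blast
  ultimately have "M \<alpha> i = uncovered \<C> S \<alpha> (C \<inter> {..<\<alpha>})"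
    using \<alpha> unfolding M_def by simp
  then obtain \<beta> where "\<beta> \<in> uncovered \<C> S \<alpha> (C \<inter> {..<\<alpha>})" "\<beta> < \<gamma>" "limit_point C \<beta>"
    using refl[OF \<alpha>(1) i(1)] acc unfolding reflects_at_def stationary_in_def by blast
  \<comment> \<open>By coherence \<open>C \<inter> {..<\<beta>}\<close> is an element of
    \<open>\<C> \<beta>\<close>, and its restriction to \<alpha> is the set that \<beta> was
    supposed to leave uncovered.\<close>
  moreover have "(C \<inter> {..<\<beta>}) \<inter> {..<\<alpha>} = C \<inter> {..<\<alpha>}" if "\<alpha> < \<beta>"
    using that by auto
  ultimately show False
    using C'(2) unfolding uncovered_def by blast
qed

text \<open>The union restricts to \<open>B \<alpha>\<close> below each \<alpha> in
  \<open>H\<close>, so its limit points below \<alpha> are limit points of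
  \<open>B \<alpha>\<close>, where coherence applies.\<close>

lemma is_thread_Union:
  fixes \<C> :: "'a::wellorder \<Rightarrow> 'a set set"
  assumes coh: "coherent_seq \<C>"
    and unb: "\<And>\<xi>. \<exists>\<alpha>\<in>H. \<xi> < \<alpha>"
    and H: "\<And>\<alpha>. \<alpha> \<in> H \<Longrightarrow> is_limit \<alpha> \<and> B \<alpha> \<in> \<C> \<alpha>"
    and chain: "\<And>x y. x \<in> H \<Longrightarrow> y \<in> H \<Longrightarrow> x \<le> y \<Longrightarrow> B y \<inter> {..<x} = B x"
  shows "is_thread \<C> (\<Union> (B ` H))"
proof -
  let ?T = "\<Union> (B ` H)"
  have B: "club_in {..<\<alpha>} (B \<alpha>)" "\<And>\<beta>. \<beta> < \<alpha> \<Longrightarrow> limit_point (B \<alpha>) \<beta> \<Longrightarrow> B \<alpha> \<inter> {..<\<beta>} \<in> \<C> \<beta>"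
    if "\<alpha> \<in> H" for \<alpha>
    using coh H[OF that] unfolding coherent_seq_def by blast+
  have T: "?T \<inter> {..<\<alpha>} = B \<alpha>" if "\<alpha> \<in> H" for \<alpha>
  proof -
    have "B \<alpha>' \<inter> {..<\<alpha>} \<subseteq> B \<alpha>" if "\<alpha>' \<in> H" for \<alpha>'
      using chain[of \<alpha> \<alpha>'] chain[of \<alpha>' \<alpha>] that \<open>\<alpha> \<in> H\<close> by (cases "\<alpha> \<le> \<alpha>'") fastforce+
    moreover have "B \<alpha> \<subseteq> {..<\<alpha>}"
      using B(1)[OF that] unfolding club_in_def by blast
    ultimately show ?thesis
      using that by blast
  qed
  have "\<exists>c\<in>?T. \<xi> \<le> c" for \<xi>
  proof -
    obtain \<alpha> where "\<alpha> \<in> H" "\<xi> < \<alpha>"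
      using unb by blast
    moreover from this obtain c where "c \<in> B \<alpha>" "\<xi> \<le> c"
      using B(1)[OF \<open>\<alpha> \<in> H\<close>] unfolding club_in_def by (meson lessThan_iff)
    ultimately show ?thesis
      by blast
  qed
  moreover have "\<beta> \<in> ?T \<and> ?T \<inter> {..<\<beta>} \<in> \<C> \<beta>" if lp: "limit_point ?T \<beta>" for \<beta>
  proof -
    obtain \<alpha> where \<alpha>: "\<alpha> \<in> H" "\<beta> < \<alpha>"
      using unb by blast
    have "\<exists>c\<in>B \<alpha>. \<xi> < c \<and> c < \<beta>" if \<xi>: "\<xi> < \<beta>" for \<xi>
    proof -
      obtain c where "c \<in> ?T" "\<xi> < c" "c < \<beta>"
        using lp \<xi> unfolding limit_point_def by blast
      moreover from this have "c \<in> B \<alpha>"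
        using T[OF \<alpha>(1)] \<alpha>(2) by auto
      ultimately show ?thesis
        by blast
    qed
    then have "limit_point (B \<alpha>) \<beta>"
      using lp unfolding limit_point_def by blast
    then have "\<beta> \<in> B \<alpha>" "B \<alpha> \<inter> {..<\<beta>} \<in> \<C> \<beta>"
      using B[OF \<alpha>(1)] \<alpha>(2) unfolding club_in_def by blast+
    moreover have "{..<\<beta>} = {..<\<alpha>} \<inter> {..<\<beta>}"
      using \<alpha>(2) by auto
    then have "?T \<inter> {..<\<beta>} = B \<alpha> \<inter> {..<\<beta>}"
      using T[OF \<alpha>(1)] by (metis Int_assoc)
    ultimately show ?thesis
      using \<alpha>(1) by auto
  qed
  ultimately show ?thesis
    unfolding is_thread_def club_in_def by blast
qed

section \<open>The tree of bad sets under end-extension\<close>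

definition extends :: "('a::wellorder \<Rightarrow> 'a set) \<Rightarrow> 'a \<Rightarrow> 'a \<Rightarrow> bool" where
  "extends B x y \<longleftrightarrow> x \<le> y \<and> B y \<inter> {..<x} = B x"

text \<open>This is the tree property: the nodes below a given node \<open>z\<close> form a
  chain.\<close>

lemma extends_if_common_extension:
  assumes "extends B x z" and "extends B y z" and "x \<le> y"
  shows "extends B x y"
proof -
  have "B y \<inter> {..<x} = B z \<inter> ({..<y} \<inter> {..<x})"
    using assms unfolding extends_def by blast
  also have "{..<y} \<inter> {..<x} = {..<x}"
    using assms(3) by auto
  finally show ?thesis
    using assms unfolding extends_def by simp
qed

theorem theorem2p1:
  fixes \<kappa> :: "'a::wellorder" and S :: "'a set"
  assumes "regular_uncountable TYPE('a)"
    and "is_cardinal \<kappa>"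
    and "\<exists>a b. a < b \<and> b < \<kappa>"
    and "stationary_in UNIV S"
    and "sDSR \<kappa> S"
  shows "\<not> square \<kappa>"
proof
  note reg = assms(1)
  assume "square \<kappa>"
  then obtain \<C> where coh: "coherent_seq \<C>" and width: "width_less \<C> \<kappa>"
    and no_thread: "\<And>T. \<not> is_thread \<C> T"
    unfolding square_def by blast
  define A where "A = {\<alpha>. is_limit \<alpha> \<and> (\<exists>C\<in>\<C> \<alpha>. \<not> stationary_in UNIV (uncovered \<C> S \<alpha> C))}"
  have "\<exists>\<alpha>\<in>A. \<rho> < \<alpha>" for \<rho>
    using unbounded_nonstationary_uncovered[OF assms(1,3,4,5) coh width, of \<rho>]
    unfolding A_def by blast
  \<comment> \<open>\<open>a\<close> turns an arbitrary ordinal into a tree node above it.\<close>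
  then obtain a where a: "\<And>x. a x \<in> A" "\<And>x. x < a x"
    by metis
  have "\<exists>C E. \<alpha> \<in> A \<longrightarrow> C \<in> \<C> \<alpha> \<and> club_in UNIV E \<and> uncovered \<C> S \<alpha> C \<inter> E = {}" for \<alpha>
    unfolding A_def stationary_in_def by blast
  then obtain B E where B: "\<And>\<alpha>. \<alpha> \<in> A \<Longrightarrow> B \<alpha> \<in> \<C> \<alpha>"
    and E: "\<And>\<alpha>. \<alpha> \<in> A \<Longrightarrow> club_in UNIV (E \<alpha>)"
    and BE: "\<And>\<alpha>. \<alpha> \<in> A \<Longrightarrow> uncovered \<C> S \<alpha> (B \<alpha>) \<inter> E \<alpha> = {}"
    by metis
  have A_lim: "is_limit \<alpha>" if "\<alpha> \<in> A" for \<alpha>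
    using that unfolding A_def by blast
  have B_sub: "B \<alpha> \<subseteq> {..<\<alpha>}" if "\<alpha> \<in> A" for \<alpha>
    using coh A_lim[OF that] B[OF that] unfolding coherent_seq_def club_in_def by blast
  have split: "\<exists>v\<in>A. \<exists>w\<in>A. \<exists>b. extends B u v \<and> extends B u w \<and>
      (\<forall>x\<in>A. b < x \<longrightarrow> \<not> (extends B v x \<and> extends B w x))" if "u \<in> A" for u
  proof (rule ccontr)
    assume "\<not> ?thesis"
    \<comment> \<open>If no pair splits, any two extensions of \<open>u\<close> have a common
      extension, so by the tree property the cone above \<open>u\<close> is a chain; the pair
      \<open>u\<close>, \<open>u\<close> shows it unbounded.\<close>
    then have high: "\<exists>x\<in>A. b < x \<and> extends B v x \<and> extends B w x"
      if "v \<in> A" "w \<in> A" "extends B u v" "extends B u w" for v w b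
      using that by blast
    let ?H = "{v\<in>A. extends B u v}"
    have "extends B u u"
      using B_sub[OF that] unfolding extends_def by auto
    then have "\<exists>\<alpha>\<in>?H. \<xi> < \<alpha>" for \<xi>
      using high[of u u \<xi>] that by blast
    moreover have "B y \<inter> {..<x} = B x" if xy: "x \<in> ?H" "y \<in> ?H" "x \<le> y" for x y
    proof -
      obtain z where "extends B x z" "extends B y z"
        using high[of x y] xy by blast
      then show ?thesis
        using extends_if_common_extension xy(3) unfolding extends_def by blast
    qed
    ultimately have "is_thread \<C> (\<Union> (B ` ?H))"
      using A_lim B by (intro is_thread_Union[OF coh]) auto
    then show False
      using no_thread by blast
  qed
  then obtain v w b where v: "\<And>u. u \<in> A \<Longrightarrow> v u \<in> A \<and> extends B u (v u)"
    and w: "\<And>u. u \<in> A \<Longrightarrow> w u \<in> A \<and> extends B u (w u)"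
    and b: "\<And>u x. u \<in> A \<Longrightarrow> x \<in> A \<Longrightarrow> b u < x \<Longrightarrow> \<not> (extends B (v u) x \<and> extends B (w u) x)"
    by metis
  have "\<exists>e. \<alpha> \<in> A \<longrightarrow> e \<in> E \<alpha> \<and> x < e" for \<alpha> x
  proof -
    obtain y where "x < y"
      using regular_no_max[OF reg] by blast
    then show ?thesis
      using E[of \<alpha>] less_le_trans unfolding club_in_def by blast
  qed
  then obtain p where p: "\<And>\<alpha> x. \<alpha> \<in> A \<Longrightarrow> p \<alpha> x \<in> E \<alpha> \<and> x < p \<alpha> x"
    by metis
  have "\<exists>y. x < y \<and> v (a x) < y \<and> w (a x) < y \<and> b (a x) < y \<and> (\<forall>\<alpha>\<le>x. p \<alpha> x < y)" for x
  proof -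
    obtain y where "\<forall>z\<in>{x, v (a x), w (a x), b (a x)}. z < y"
      using regular_countable_bounded[OF reg, of "{x, v (a x), w (a x), b (a x)}"] by auto
    moreover obtain z where "\<forall>\<alpha>\<le>x. p \<alpha> x < z"
      using regular_image_bounded[OF reg, of x "\<lambda>\<alpha>. p \<alpha> x"] by blast
    ultimately show ?thesis
      by (intro exI[of _ "max y z"]) (auto simp: less_max_iff_disj)
  qed
  \<comment> \<open>Closure under \<open>g\<close> passes beyond the split of \<open>a x\<close>
    together with its bound \<open>b (a x)\<close>, and beyond elements of every
    \<open>E \<alpha>\<close> with \<alpha> \<le> \<open>x\<close>.\<close>
  then obtain g where g: "\<And>x. x < g x" "\<And>x. v (a x) < g x" "\<And>x. w (a x) < g x"
    "\<And>x. b (a x) < g x" "\<And>x \<alpha>. \<alpha> \<le> x \<Longrightarrow> p \<alpha> x < g x"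
    by metis
  define K where "K = closure_points g"
  have K_club: "club_in UNIV K"
    unfolding K_def using reg by (rule club_in_closure_points)
  have K: "g x < e" if "e \<in> K" "x < e" for e x
    using that unfolding K_def closure_points_def by blast
  have K_lim: "is_limit e" if "e \<in> K" for e
    using K[OF that] g(1) that unfolding is_limit_def K_def closure_points_def by blast
  \<comment> \<open>\<open>K\<close> lies in the diagonal intersection of the clubs
    \<open>E \<alpha>\<close>: each of its points above \<alpha> is a limit of
    \<open>E \<alpha>\<close>. The maximum \<open>m\<close> is taken because \<open>g m\<close>
    bounds \<open>p \<alpha> m\<close> only for \<alpha> \<le> \<open>m\<close>.\<close>
  have K_E: "e \<in> E \<alpha>" if "e \<in> K" "\<alpha> \<in> A" "\<alpha> < e" for e \<alpha>
  proof -
    have "\<exists>c\<in>E \<alpha>. \<xi> < c \<and> c < e" if "\<xi> < e" for \<xi>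
    proof -
      define m where "m = max \<xi> \<alpha>"
      have m: "\<xi> \<le> m" "\<alpha> \<le> m" "m < e"
        using that \<open>\<alpha> < e\<close> unfolding m_def by auto
      have "p \<alpha> m < e"
        using g(5)[OF m(2)] K[OF \<open>e \<in> K\<close> m(3)] by (rule less_trans)
      then show ?thesis
        using p[OF \<open>\<alpha> \<in> A\<close>, of m] m(1) le_less_trans by blast
    qed
    then have "limit_point (E \<alpha>) e"
      using K_lim[OF that(1)] unfolding limit_point_def by blast
    then show ?thesis
      using E[OF that(2)] unfolding club_in_def by blast
  qed
  have "\<not> K \<prec> (UNIV :: 'a set)"
    using reg K_club unfolding regular_uncountable_def club_in_def by simp
  then have "(UNIV :: 'a set) \<lesssim> K"
    unfolding lesspoll_def
    using subset_imp_lepoll[OF subset_UNIV] eqpoll_imp_lepoll[OF eqpoll_sym] by metis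
  then obtain h :: "'a \<Rightarrow> 'a" where h: "inj h" "range h \<subseteq> K"
    unfolding lepoll_def by blast
  \<comment> \<open>Since \<kappa> may be finite, two parts of \<open>K\<close> are placed below
    \<beta>: an infinite one, which makes \<open>\<C> \<beta>\<close> infinite, and one of size
    \<kappa>, which contradicts the width.\<close>
  have "infinite (UNIV :: 'a set)"
    using reg countable_finite unfolding regular_uncountable_def by blast
  from infinite_countable_subset'[OF this]
  obtain N :: "'a set" where N: "countable N" "infinite N"
    by blast
  have bounded: "\<exists>r. \<forall>x\<in>h ` X. x < r" if "X \<prec> (UNIV :: 'a set)" for X
    using regular_bounded[OF reg] that image_lepoll lesspoll_trans1 by blast
  from bounded[OF regular_countable_lesspoll[OF reg N(1)]]
  obtain r where r: "\<forall>x\<in>h ` N. x < r"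
    by blast
  have "{..<\<kappa>} \<prec> (UNIV :: 'a set)"
    using reg unfolding regular_uncountable_def by blast
  from bounded[OF this] obtain s where s: "\<forall>x\<in>h ` {..<\<kappa>}. x < s"
    by blast
  have "club_in UNIV (K \<inter> {max r s<..})"
    by (rule club_in_Int_greaterThan[OF K_club]) (use regular_no_max[OF reg] in blast)
  then have "S \<inter> (K \<inter> {max r s<..}) \<noteq> {}"
    using assms(4) unfolding stationary_in_def by blast
  then obtain \<beta> where \<beta>: "\<beta> \<in> S" "\<beta> \<in> K" "max r s < \<beta>"
    by blast
  have "\<exists>D\<in>\<C> \<beta>. D \<inter> {..<\<alpha>} = B \<alpha>" if "\<alpha> \<in> A" "\<alpha> < \<beta>" for \<alpha>
    using BE[OF that(1)] K_E[OF \<beta>(2) that] \<beta>(1) that(2) unfolding uncovered_def by blast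
  then obtain D where D: "\<And>\<alpha>. \<alpha> \<in> A \<Longrightarrow> \<alpha> < \<beta> \<Longrightarrow> D \<alpha> \<in> \<C> \<beta> \<and> D \<alpha> \<inter> {..<\<alpha>} = B \<alpha>"
    by metis
  have vw: "v (a e) < \<beta>" "w (a e) < \<beta>" if "e \<in> K \<inter> {..<\<beta>}" for e
    using g(2,3)[of e] K[OF \<beta>(2), of e] that less_trans by auto
  \<comment> \<open>Two nodes cut from the same element of \<open>\<C> \<beta>\<close> are
    comparable in the tree.\<close>
  have D_eq: "extends B x y" if "x \<in> A" "y \<in> A" "x \<le> y" "y < \<beta>" "D x = D y" for x y
  proof -
    have "B y \<inter> {..<x} = D y \<inter> ({..<y} \<inter> {..<x})"
      using D that by blast
    also have "{..<y} \<inter> {..<x} = {..<x}"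
      using that by auto
    finally show ?thesis
      using D[of x] that unfolding extends_def by simp
  qed
  have "inj_on (\<lambda>e. (D (v (a e)), D (w (a e)))) (K \<inter> {..<\<beta>})"
  proof (rule linorder_inj_onI)
    fix e e' assume e: "e < e'" "e \<in> K \<inter> {..<\<beta>}" "e' \<in> K \<inter> {..<\<beta>}"
    have "g e < e'"
      using K e by blast
    then have less: "v (a e) < a e'" "w (a e) < a e'" "b (a e) < a e'"
      using g(2,3,4)[of e] a(2)[of e'] by auto
    show "(D (v (a e)), D (w (a e))) \<noteq> (D (v (a e')), D (w (a e')))"
    proof
      assume "(D (v (a e)), D (w (a e))) = (D (v (a e')), D (w (a e')))"
      then have eq: "D (v (a e)) = D (v (a e'))" "D (w (a e)) = D (w (a e'))"
        by auto
      have le: "a e' \<le> v (a e')" "a e' \<le> w (a e')"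
        using v w a unfolding extends_def by blast+
      have "extends B (v (a e)) (v (a e'))"
        using D_eq eq(1) v a(1) vw e less le by auto
      \<comment> \<open>Both \<open>v (a e)\<close> and \<open>a e'\<close> lie below
        \<open>v (a e')\<close> in the tree, hence are comparable. With the same argument for
        \<open>w\<close>, the node \<open>a e'\<close> is a common extension of the split pair
        beyond its bound.\<close>
      then have "extends B (v (a e)) (a e')"
        using v a(1) less(1) by (meson extends_if_common_extension less_imp_le)
      moreover have "extends B (w (a e)) (w (a e'))"
        using D_eq eq(2) w a(1) vw e less le by auto
      then have "extends B (w (a e)) (a e')"
        using w a(1) less(2) by (meson extends_if_common_extension less_imp_le)
      ultimately show False
        using b a(1) less(3) by blast
    qed
  qed auto
  moreover have "(\<lambda>e. (D (v (a e)), D (w (a e)))) ` (K \<inter> {..<\<beta>}) \<subseteq> \<C> \<beta> \<times> \<C> \<beta>"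
    using D v w a(1) vw by auto
  ultimately have le: "K \<inter> {..<\<beta>} \<lesssim> \<C> \<beta> \<times> \<C> \<beta>"
    unfolding lepoll_def by blast
  have below: "h x \<in> K \<inter> {..<\<beta>}" if "h x < max r s" for x
    using h(2) less_trans[OF that \<beta>(3)] by blast
  then have "h ` N \<subseteq> K \<inter> {..<\<beta>}"
    using r by (simp add: image_subset_iff less_max_iff_disj)
  then have "infinite (K \<inter> {..<\<beta>})"
    using N(2) finite_subset finite_imageD inj_on_subset[OF h(1) subset_UNIV] by blast
  then have "infinite (\<C> \<beta>)"
    using le infinite_le_lepoll lepoll_trans finite_cartesian_product by metis
  then have sq: "\<C> \<beta> \<times> \<C> \<beta> \<approx> \<C> \<beta>"
    by (rule infinite_square_eqpoll)
  have "h ` {..<\<kappa>} \<subseteq> K \<inter> {..<\<beta>}"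
    using s below by (simp add: image_subset_iff less_max_iff_disj)
  then have "{..<\<kappa>} \<lesssim> K \<inter> {..<\<beta>}"
    using inj_on_subset[OF h(1) subset_UNIV] unfolding lepoll_def by blast
  also have "K \<inter> {..<\<beta>} \<lesssim> \<C> \<beta> \<times> \<C> \<beta>"
    by (rule le)
  also note sq
  also have "\<C> \<beta> \<prec> {..<\<kappa>}"
    using width K_lim[OF \<beta>(2)] unfolding width_less_def by blast
  finally show False
    by simp
qed

end
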